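(* For any finite simple graph $G$ without isolated vertices (with at least one vertex): (i) $\alpha_h(G)/\alpha_{\mathrm{bn}}(G)<2$, and (ii) $\alpha_h(G)/\alpha_{\mathrm{bnr}}(G)<3$. Both bounds are asymptotically best possible: for every $\varepsilon>0$ there is a graph $G$ with $\alpha_h(G)/\alpha_{\mathrm{bn}}(G)>2-\varepsilon$, and for every $\varepsilon>0$ there is a graph $G$ with $\alpha_h(G)/\alpha_{\mathrm{bnr}}(G)>3-\varepsilon$.
   Context: Graphs are finite and simple; $d$ is graph distance and $e(v)$ is the eccentricity of $v$. A broadcast on a nontrivial connected graph $G=(V,E)$ is a function $f:V\to\{0,1,\dots,\operatorname{diam}(G)\}$ with $f(v)\le e(v)$ for all $v\in V$. When $G$ is disconnected, a broadcast on $G$ is the union of broadcasts on its components (vertices in different components are at infinite distance). Its weight is $\sigma(f)=\sum_{v\in V}f(v)$. Let $V_f^+=\{v\in V: f(v)>0\}$ (the broadcasting vertices). A vertex $u$ hears $f$ from $v\in V_f^+$ if $d(u,v)\le f(v)$ (so a broadcasting vertex hears itself). Put $N_f(v)=\{u\in V:d(u,v)\le f(v)\}$. For $v\in V_f^+$, the private boundary $\operatorname{PB}_f(v)$ is the set of all $u\in N_f(v)$ that do not hear the broadcast obtained from $f$ by replacing the value $f(v)$ by $f(v)-1$ (all other values unchanged) from any of its broadcasting vertices. A broadcast $f$ is h-independent (hearing independent) if no vertex $u\in V_f^+$ hears $f$ from any other vertex $v\in V_f^+$. It is bn-independent (boundary independent) if whenever a vertex $x$ hears $f$ from more than one vertex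 of $V_f^+$, then $d(x,u)\ge f(u)$ for all $u\in V_f^+$ (equivalently, $d(x,u)=f(u)$ for every $u\in V_f^+$ from which $x$ hears $f$). It is bnr-independent if it is bn-independent and irredundant, i.e. $\operatorname{PB}_f(v)\ne\varnothing$ for every $v\in V_f^+$. The numbers $\alpha_h(G)$, $\alpha_{\mathrm{bn}}(G)$, $\alpha_{\mathrm{bnr}}(G)$ are the maximum weights of an h-, bn-, bnr-independent broadcast on $G$, respectively. *)

theory Defs
  imports "Graph_Theory.Graph_Theory"
begin

text \<open>
  Finite simple graphs are the locale \<^locale>\<open>graph\<close>: finite symmetric digraphs without loops
  and without parallel arcs.
\<close>

definition no_isolated_verts :: "('a, 'b) pre_digraph \<Rightarrow> bool" where
  "no_isolated_verts G \<longleftrightarrow> (\<forall>v \<in> verts G. \<exists>u. v \<rightarrow>\<^bsub>G\<^esub> u)"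

text \<open>Unit arc weights; the value is \<open>\<infinity>\<close> for vertices in different components.\<close>
definition gdist :: "('a, 'b) pre_digraph \<Rightarrow> 'a \<Rightarrow> 'a \<Rightarrow> ereal" where
  "gdist G u v = wf_digraph.\<mu> G (\<lambda>_. 1) u v"

definition eccentricity :: "('a, 'b) pre_digraph \<Rightarrow> 'a \<Rightarrow> ereal" where
  "eccentricity G v = (SUP u \<in> verts G. gdist G v u)"

definition diam :: "('a, 'b) pre_digraph \<Rightarrow> ereal" where
  "diam G = (SUP v \<in> verts G. eccentricity G v)"

definition connected_broadcast :: "('a, 'b) pre_digraph \<Rightarrow> ('a \<Rightarrow> nat) \<Rightarrow> bool" where
  "connected_broadcast G f \<longleftrightarrow>
     (\<forall>v \<in> verts G. ereal (real (f v)) \<le> diam G \<and> ereal (real (f v)) \<le> eccentricity G v)"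

text \<open>
  In a symmetric digraph the strongly connected components are the connected components.
  The values of \<open>f\<close> outside \<^term>\<open>verts G\<close> are unconstrained and never used.
\<close>
definition broadcast :: "('a, 'b) pre_digraph \<Rightarrow> ('a \<Rightarrow> nat) \<Rightarrow> bool" where
  "broadcast G f \<longleftrightarrow> (\<forall>H \<in> pre_digraph.sccs G. connected_broadcast H f)"

definition broadcast_weight :: "('a, 'b) pre_digraph \<Rightarrow> ('a \<Rightarrow> nat) \<Rightarrow> nat" where
  "broadcast_weight G f = (\<Sum>v \<in> verts G. f v)"

definition broadcasting :: "('a, 'b) pre_digraph \<Rightarrow> ('a \<Rightarrow> nat) \<Rightarrow> 'a set" where
  "broadcasting G f = {v \<in> verts G. f v > 0}"

definition hears :: "('a, 'b) pre_digraph \<Rightarrow> ('a \<Rightarrow> nat) \<Rightarrow> 'a \<Rightarrow> 'a \<Rightarrow> bool" where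
  "hears G f u v \<longleftrightarrow>
     u \<in> verts G \<and> v \<in> broadcasting G f \<and> gdist G u v \<le> ereal (real (f v))"

definition broadcast_nbhd :: "('a, 'b) pre_digraph \<Rightarrow> ('a \<Rightarrow> nat) \<Rightarrow> 'a \<Rightarrow> 'a set" where
  "broadcast_nbhd G f v = {u \<in> verts G. gdist G u v \<le> ereal (real (f v))}"

definition private_boundary :: "('a, 'b) pre_digraph \<Rightarrow> ('a \<Rightarrow> nat) \<Rightarrow> 'a \<Rightarrow> 'a set" where
  "private_boundary G f v =
     {u \<in> broadcast_nbhd G f v. \<not> (\<exists>w. hears G (f(v := f v - 1)) u w)}"

definition h_independent :: "('a, 'b) pre_digraph \<Rightarrow> ('a \<Rightarrow> nat) \<Rightarrow> bool" where
  "h_independent G f \<longleftrightarrow> broadcast G f \<and>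
     (\<forall>u \<in> broadcasting G f. \<forall>v \<in> broadcasting G f. u \<noteq> v \<longrightarrow> \<not> hears G f u v)"

definition bn_independent :: "('a, 'b) pre_digraph \<Rightarrow> ('a \<Rightarrow> nat) \<Rightarrow> bool" where
  "bn_independent G f \<longleftrightarrow> broadcast G f \<and>
     (\<forall>x \<in> verts G. (\<exists>v w. v \<noteq> w \<and> hears G f x v \<and> hears G f x w) \<longrightarrow>
        (\<forall>u \<in> broadcasting G f. gdist G x u \<ge> ereal (real (f u))))"

definition irredundant :: "('a, 'b) pre_digraph \<Rightarrow> ('a \<Rightarrow> nat) \<Rightarrow> bool" where
  "irredundant G f \<longleftrightarrow> (\<forall>v \<in> broadcasting G f. private_boundary G f v \<noteq> {})"

definition bnr_independent :: "('a, 'b) pre_digraph \<Rightarrow> ('a \<Rightarrow> nat) \<Rightarrow> bool" where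
  "bnr_independent G f \<longleftrightarrow> bn_independent G f \<and> irredundant G f"

text \<open>
  For a finite graph the sets of weights below are finite, since eccentricities taken
  within a component are finite, and they contain \<open>0\<close>, the weight of the zero broadcast.
\<close>
definition alpha_h :: "('a, 'b) pre_digraph \<Rightarrow> nat" where
  "alpha_h G = Max (broadcast_weight G ` {f. h_independent G f})"

definition alpha_bn :: "('a, 'b) pre_digraph \<Rightarrow> nat" where
  "alpha_bn G = Max (broadcast_weight G ` {f. bn_independent G f})"

definition alpha_bnr :: "('a, 'b) pre_digraph \<Rightarrow> nat" where
  "alpha_bnr G = Max (broadcast_weight G ` {f. bnr_independent G f})"

end

theory Submission
  imports Defs
begin

text \<open>
  If \<open>f\<close> is h-independent, two broadcasting vertices \<open>u\<close>, \<open>v\<close> are more than \<open>max (f u) (f v)\<close> apart.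
  Hence the values can be halved, rounding up, and even increased by one at a single vertex where
  \<open>f\<close> is even, keeping \<open>g u + g v \<le> d u v\<close>; this makes \<open>g\<close> bn-independent with \<open>2 \<sigma>(g) > \<sigma>(f)\<close>.
  Rounding down instead (but not below 1) makes the inequality strict where it matters, so that every
  boundary is private; the ratio 3 would need \<open>f v = 3\<close> throughout, but at one such vertex
  \<open>g v = 2\<close> is still admissible.

  Sharpness for bn: on a path with \<open>N + 1\<close> edges, value \<open>N\<close> at both ends is h-independent, whereas a
  bn-independent broadcast has weight at most the number of edges. Sharpness for bnr: on the
  spider with \<open>n + 1\<close> legs of length 2, value 3 at the leaves is h-independent, whereas in a
  bnr-independent broadcast at most one leg has weight above 1, because two such legs would both
  reach the centre exactly, which is then in the private boundary of neither.
\<close>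

section \<open>Distances\<close>

context wf_digraph
begin

lemma unit_awalk_cost: "awalk_cost (\<lambda>_. 1) p = real (length p)"
  by (induction p) auto

lemma gdist_le_length: "awalk u p v \<Longrightarrow> gdist G u v \<le> ereal (real (length p))"
  using min_cost_le_walk_cost[of u p v "\<lambda>_. 1"] by (simp add: gdist_def unit_awalk_cost)

lemma gdist_greatest:
  assumes "\<And>p. awalk u p v \<Longrightarrow> x \<le> ereal (real (length p))"
  shows "x \<le> gdist G u v"
  unfolding gdist_def \<mu>_def by (rule INF_greatest) (use assms in \<open>simp add: unit_awalk_cost\<close>)

lemma gdist_nonneg: "0 \<le> gdist G u v"
  by (rule gdist_greatest) simp

lemma gdist_self: "u \<in> verts G \<Longrightarrow> gdist G u u = 0"
  using gdist_le_length[of u "[]" u] gdist_nonneg[of u u]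
  by (auto simp: awalk_Nil_iff zero_ereal_def)

text \<open>A walk starting at a vertex reachable from \<open>u\<close> never leaves the set
  reachable from \<open>u\<close>, so its arcs survive in the induced component. Distances inside a
  component are therefore at most those in \<open>G\<close>.\<close>

lemma awalk_induce_reachable:
  assumes "awalk v p w" "u \<rightarrow>\<^sup>* v"
  shows "pre_digraph.awalk (G \<restriction> {x. u \<rightarrow>\<^sup>* x}) v p w"
proof -
  let ?H = "G \<restriction> {x. u \<rightarrow>\<^sup>* x}"
  interpret H: wf_digraph ?H by (rule wellformed_induce_subgraph)
  show ?thesis using assms
  proof (induction p arbitrary: v)
    case Nil
    then show ?case by (auto simp: awalk_Nil_iff H.awalk_Nil_iff)
  next
    case (Cons e p)
    then have e: "e \<in> arcs G" "tail G e = v" "awalk (head G e) p w"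
      by (auto simp: awalk_Cons_iff)
    then have "u \<rightarrow>\<^sup>* head G e"
      using Cons.prems by (metis reachable_adj_trans dominatesI arc_to_ends_def)
    with Cons e show ?case by (auto simp: H.awalk_Cons_iff)
  qed
qed

end

context fin_digraph
begin

text \<open>When \<open>v\<close> is reachable from \<open>u\<close>, a cheapest walk exists and may
  be chosen without repeated vertices; this later bounds finite distances by the number of
  vertices.\<close>

lemma gdist_cases:
  obtains "gdist G u v = \<infinity>"
  | p where "apath u p v" "gdist G u v = ereal (real (length p))"
proof (cases "u \<rightarrow>\<^sup>* v")
  case True
  then obtain p where "apath u p v" "\<mu> (\<lambda>_. 1) u v = ereal (awalk_cost (\<lambda>_. 1) p)"
    using min_cost_awalk[of u v "\<lambda>_. 1"] by auto
  then show thesis using that by (auto simp: gdist_def unit_awalk_cost)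
next
  case False
  then show thesis using that shortest_path_inf by (auto simp: gdist_def)
qed

lemma gdist_nat_or_infinity:
  obtains "gdist G u v = \<infinity>" | n where "gdist G u v = ereal (real n)"
  by (rule gdist_cases[of u v]) auto

lemma gdist_triangle: "gdist G u w \<le> gdist G u v + gdist G v w"
proof (rule gdist_cases[of u v])
  assume "gdist G u v = \<infinity>"
  then show ?thesis using gdist_nonneg[of v w] by simp
next
  fix p assume p: "apath u p v" "gdist G u v = ereal (real (length p))"
  show ?thesis
  proof (rule gdist_cases[of v w])
    assume "gdist G v w = \<infinity>"
    then show ?thesis using p by simp
  next
    fix q assume q: "apath v q w" "gdist G v w = ereal (real (length q))"
    have "awalk u (p @ q) w"
      using p q by (auto simp: apath_def intro: awalk_appendI)
    then have "gdist G u w \<le> ereal (real (length (p @ q)))" by (rule gdist_le_length)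
    then show ?thesis using p q by simp
  qed
qed

text \<open>Cut a shortest walk after \<open>k\<close> arcs: a cut vertex nearer to \<open>u\<close>
  than \<open>k\<close> would, by the triangle inequality, make \<open>v\<close> too near.\<close>

lemma ex_gdist_eq:
  assumes "gdist G u v \<noteq> \<infinity>" "ereal (real k) \<le> gdist G u v"
  obtains x where "x \<in> verts G" "gdist G u x = ereal (real k)"
proof -
  obtain p where p: "awalk u p v" and d: "gdist G u v = ereal (real (length p))"
    using assms(1) by (cases rule: gdist_cases[of u v]) (auto simp: apath_def)
  have k: "k \<le> length p" using assms(2) d by simp
  have "awalk u (take k p @ drop k p) v" using p by simp
  then obtain x where x: "awalk u (take k p) x" "awalk x (drop k p) v"
    unfolding awalk_append_iff by blast
  have up: "gdist G u x \<le> ereal (real k)"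
    using gdist_le_length[OF x(1)] k by simp
  have "gdist G u v \<le> gdist G u x + gdist G x v" by (rule gdist_triangle)
  also have "\<dots> \<le> gdist G u x + ereal (real (length p - k))"
    using gdist_le_length[OF x(2)] by (intro add_left_mono) simp
  finally have "ereal (real (length p)) \<le> gdist G u x + ereal (real (length p - k))"
    using d by simp
  then have "ereal (real k) \<le> gdist G u x"
    using k by (cases "gdist G u x") (auto simp: of_nat_diff)
  with up have "gdist G u x = ereal (real k)" by simp
  moreover have "x \<in> verts G" using x(1) by auto
  ultimately show thesis using that by blast
qed

end

context sym_digraph
begin

lemma awalk_reverse:
  assumes "awalk u p v"
  obtains q where "awalk v q u" "length q = length p"
proof -
  have "\<exists>q. awalk v q u \<and> length q = length p"
    using assms
  proof (induction p arbitrary: u)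
    case Nil
    then show ?case by (auto simp: awalk_Nil_iff)
  next
    case (Cons e p)
    then have e: "e \<in> arcs G" "tail G e = u" "awalk (head G e) p v"
      by (auto simp: awalk_Cons_iff)
    obtain q where q: "awalk v q (head G e)" "length q = length p"
      using Cons.IH[OF e(3)] by auto
    obtain e' where "e' \<in> arcs G" "tail G e' = head G e" "head G e' = u"
      using sym_arcs e unfolding symmetric_conv by metis
    then have "awalk (head G e) [e'] u" by (auto simp: awalk_simps)
    with q have "awalk v (q @ [e']) u" by (auto intro: awalk_appendI)
    with q show ?case by (intro exI[of _ "q @ [e']"]) auto
  qed
  then show thesis using that by blast
qed

lemma gdist_commute: "gdist G u v = gdist G v u"
proof -
  have "gdist G u v \<le> gdist G v u" for u v
    by (rule gdist_greatest) (metis awalk_reverse gdist_le_length)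
  then show ?thesis by (simp add: antisym)
qed

end

section \<open>Sufficient conditions for being a broadcast\<close>

lemma broadcast_mono:
  assumes "broadcast G f" "\<And>v. g v \<le> f v"
  shows "broadcast G g"
  unfolding broadcast_def connected_broadcast_def
proof (intro ballI)
  fix H v assume "H \<in> pre_digraph.sccs G" "v \<in> verts H"
  then have "ereal (real (f v)) \<le> diam H \<and> ereal (real (f v)) \<le> eccentricity H v"
    using assms(1) by (auto simp: broadcast_def connected_broadcast_def)
  moreover have "ereal (real (g v)) \<le> ereal (real (f v))" using assms(2) by simp
  ultimately show "ereal (real (g v)) \<le> diam H \<and> ereal (real (g v)) \<le> eccentricity H v"
    by (meson order_trans)
qed

text \<open>One sufficiently distant vertex bounds the eccentricity from below, and the diameter is
  the supremum of the eccentricities.\<close>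

lemma (in wf_digraph) connected_broadcastI:
  assumes "\<And>v. v \<in> verts G \<Longrightarrow> \<exists>u \<in> verts G. ereal (real (f v)) \<le> gdist G v u"
  shows "connected_broadcast G f"
  unfolding connected_broadcast_def
proof (intro ballI)
  fix v assume v: "v \<in> verts G"
  have "ereal (real (f v)) \<le> eccentricity G v"
    unfolding eccentricity_def using assms[OF v] by (meson SUP_upper2)
  moreover from this have "ereal (real (f v)) \<le> diam G"
    unfolding diam_def using v by (meson SUP_upper2)
  ultimately show "ereal (real (f v)) \<le> diam G \<and> ereal (real (f v)) \<le> eccentricity G v"
    by simp
qed

lemma (in wf_digraph) broadcast_zero: "broadcast G (\<lambda>_. 0)"
  unfolding broadcast_def
proof
  fix H assume H: "H \<in> sccs"
  then interpret H: wf_digraph H by (auto simp: sccs_def induced_subgraph_def subgraph_def)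
  show "connected_broadcast H (\<lambda>_. 0)"
    by (rule H.connected_broadcastI) (auto simp: H.gdist_nonneg zero_ereal_def[symmetric])
qed

lemma (in wf_digraph) strongly_connected_broadcastI:
  assumes "strongly_connected G"
    and "\<And>v. v \<in> verts G \<Longrightarrow> \<exists>u \<in> verts G. ereal (real (f v)) \<le> gdist G v u"
  shows "broadcast G f"
proof -
  have "sccs = {G}" using assms(1) by (simp add: strongly_connected_eq_iff)
  then show ?thesis using connected_broadcastI[of f] assms(2) by (simp add: broadcast_def)
qed

section \<open>Upper bounds on the ratios\<close>

context pseudo_graph
begin

text \<open>The eccentricity within the finite component of \<open>v\<close> is an attained maximum.
  This trades the componentwise definition for a witness measured in \<open>G\<close>
  itself.\<close>

lemma broadcast_reaches:
  assumes "broadcast G f" "v \<in> verts G"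
  obtains u where "u \<in> verts G" "gdist G v u \<noteq> \<infinity>" "ereal (real (f v)) \<le> gdist G v u"
proof -
  let ?C = "{w. v \<rightarrow>\<^sup>* w}" and ?H = "G \<restriction> {w. v \<rightarrow>\<^sup>* w}"
  interpret H: wf_digraph ?H by (rule wellformed_induce_subgraph)
  have C: "?C \<subseteq> verts G" by (auto elim: reachable_in_vertsE)
  then have fin: "finite ?C" by (rule finite_subset) simp
  have v: "v \<in> ?C" using assms(2) by auto
  have "?H \<in> sccs" using assms(2) by (rule induce_reachable_is_in_sccs)
  then have "ereal (real (f v)) \<le> eccentricity ?H v"
    using assms(1) v by (auto simp: broadcast_def connected_broadcast_def)
  also have "\<dots> = Max (gdist ?H v ` ?C)"
    unfolding eccentricity_def using fin v
    by (subst Max_Sup) auto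
  also have "Max (gdist ?H v ` ?C) \<in> gdist ?H v ` ?C"
    using fin v by (intro Max_in) auto
  then obtain u where u: "u \<in> ?C" "Max (gdist ?H v ` ?C) = gdist ?H v u" by auto
  note u(2)
  also have "gdist ?H v u \<le> gdist G v u"
    using assms(2) by (intro gdist_greatest H.gdist_le_length awalk_induce_reachable) auto
  finally have "ereal (real (f v)) \<le> gdist G v u" .
  moreover have "gdist G v u \<noteq> \<infinity>"
    using \<mu>_reach_conv[of "\<lambda>_. 1" v u] u(1) by (auto simp: gdist_def)
  ultimately show thesis using that u(1) C by blast
qed

section \<open>Finiteness and attainment of the maximum weights\<close>

lemma broadcast_le_card:
  assumes "broadcast G f" "v \<in> verts G"
  shows "f v \<le> card (verts G)"
proof -
  obtain u where u: "gdist G v u \<noteq> \<infinity>" "ereal (real (f v)) \<le> gdist G v u"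
    using broadcast_reaches[OF assms] by blast
  then obtain p where "apath v p u" "f v \<le> length p"
    by (cases rule: gdist_cases[of v u]) auto
  then show ?thesis using length_apath_less[of v p u] by simp
qed

text \<open>The set of functions \<open>f\<close> may be infinite, since values off
  \<open>verts G\<close> are free; only the set of weights is bounded. This is what makes
  \<open>Max\<close> meaningful.\<close>

lemma finite_broadcast_weights:
  assumes "\<And>f. P f \<Longrightarrow> broadcast G f"
  shows "finite (broadcast_weight G ` {f. P f})"
proof (rule finite_subset)
  show "broadcast_weight G ` {f. P f} \<subseteq> {..card (verts G) * card (verts G)}"
    using assms broadcast_le_card
    by (auto simp: broadcast_weight_def intro!: sum_bounded_above[where K="card (verts G)", simplified])
qed simp

lemma h_independent_weight_le: "h_independent G f \<Longrightarrow> broadcast_weight G f \<le> alpha_h G"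
  unfolding alpha_h_def
  by (intro Max_ge finite_broadcast_weights) (auto simp: h_independent_def)

lemma bn_independent_weight_le: "bn_independent G f \<Longrightarrow> broadcast_weight G f \<le> alpha_bn G"
  unfolding alpha_bn_def
  by (intro Max_ge finite_broadcast_weights) (auto simp: bn_independent_def)

lemma bnr_independent_weight_le: "bnr_independent G f \<Longrightarrow> broadcast_weight G f \<le> alpha_bnr G"
  unfolding alpha_bnr_def
  by (intro Max_ge finite_broadcast_weights) (auto simp: bnr_independent_def bn_independent_def)

lemma h_independent_zero: "h_independent G (\<lambda>_. 0)"
  and bnr_independent_zero: "bnr_independent G (\<lambda>_. 0)"
  using broadcast_zero
  by (auto simp: h_independent_def bnr_independent_def bn_independent_def irredundant_def
      broadcasting_def hears_def)

lemma max_broadcast_weight_attained: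
  assumes "\<And>f. P f \<Longrightarrow> broadcast G f" "P (\<lambda>_. 0)"
  obtains f where "P f" "broadcast_weight G f = Max (broadcast_weight G ` {f. P f})"
proof -
  have "Max (broadcast_weight G ` {f. P f}) \<in> broadcast_weight G ` {f. P f}"
    using assms(2) by (intro Max_in finite_broadcast_weights assms(1)) auto
  then show thesis using that by auto
qed

lemma alpha_h_attained:
  obtains f where "h_independent G f" "broadcast_weight G f = alpha_h G"
  unfolding alpha_h_def
proof (rule max_broadcast_weight_attained[of "h_independent G"])
  show "broadcast G f" if "h_independent G f" for f
    using that by (simp add: h_independent_def)
  show "h_independent G (\<lambda>_. 0)"
    using h_independent_zero by (simp add: bnr_independent_def)
qed (use that in blast)

lemma alpha_bn_attained:
  obtains f where "bn_independent G f" "broadcast_weight G f = alpha_bn G"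
  unfolding alpha_bn_def
proof (rule max_broadcast_weight_attained[of "bn_independent G"])
  show "broadcast G f" if "bn_independent G f" for f
    using that by (simp add: bnr_independent_def bn_independent_def)
  show "bn_independent G (\<lambda>_. 0)"
    using bnr_independent_zero by (simp add: bnr_independent_def)
qed (use that in blast)

lemma alpha_bnr_attained:
  obtains f where "bnr_independent G f" "broadcast_weight G f = alpha_bnr G"
  unfolding alpha_bnr_def
proof (rule max_broadcast_weight_attained[of "bnr_independent G"])
  show "broadcast G f" if "bnr_independent G f" for f
    using that by (simp add: bnr_independent_def bn_independent_def)
  show "bnr_independent G (\<lambda>_. 0)"
    using bnr_independent_zero by (simp add: bnr_independent_def)
qed (use that in blast)

section \<open>Separation criteria for independence and irredundance\<close>

lemma ex_boundary_vertex:
  assumes "broadcast G f" "v \<in> verts G" "k \<le> f v"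
  obtains x where "x \<in> verts G" "gdist G v x = ereal (real k)"
proof -
  obtain u where u: "gdist G v u \<noteq> \<infinity>" "ereal (real (f v)) \<le> gdist G v u"
    using broadcast_reaches[OF assms(1,2)] by blast
  have "ereal (real k) \<le> ereal (real (f v))" using assms(3) by simp
  also note u(2)
  finally show thesis using ex_gdist_eq[OF u(1)] that by blast
qed

text \<open>If \<open>x\<close> hears two vertices, one of them is some \<open>v\<close> other than
  \<open>u\<close>; then the distance from \<open>x\<close> to \<open>u\<close> is at least
  \<open>g u + g v\<close> minus \<open>g v\<close>.\<close>

lemma bn_independentI:
  assumes "broadcast G g"
    and sep: "\<And>u v. u \<in> broadcasting G g \<Longrightarrow> v \<in> broadcasting G g \<Longrightarrow> u \<noteq> v \<Longrightarrow>
      ereal (real (g u + g v)) \<le> gdist G u v"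
  shows "bn_independent G g"
  unfolding bn_independent_def
proof (intro conjI ballI impI assms(1))
  fix x u
  assume x: "x \<in> verts G" and ex: "\<exists>v w. v \<noteq> w \<and> hears G g x v \<and> hears G g x w"
    and u: "u \<in> broadcasting G g"
  obtain v where v: "v \<noteq> u" "hears G g x v" using ex by metis
  have "ereal (real (g u + g v)) \<le> gdist G u v"
    using sep u v by (auto simp: hears_def)
  also have "\<dots> \<le> gdist G x u + gdist G x v"
    using gdist_triangle[of u v x] gdist_commute[of u x] by simp
  also have "\<dots> \<le> gdist G x u + ereal (real (g v))"
    using v by (auto simp: hears_def intro: add_left_mono)
  finally show "ereal (real (g u)) \<le> gdist G x u"
    by (cases "gdist G x u") auto
qed

text \<open>For \<open>g v > 1\<close> a vertex at distance exactly \<open>g v\<close> from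
  \<open>v\<close> is private, by strict separation. For \<open>g v = 1\<close> the vertex
  \<open>v\<close> itself is private once it is switched off, so it suffices that no other broadcast
  reaches it; hence the second disjunct.\<close>

lemma irredundantI:
  assumes "broadcast G g"
    and sep: "\<And>u v. u \<in> broadcasting G g \<Longrightarrow> v \<in> broadcasting G g \<Longrightarrow> u \<noteq> v \<Longrightarrow>
      ereal (real (g u + g v)) < gdist G u v \<or> g u = 1 \<and> ereal (real (g v)) < gdist G u v"
  shows "irredundant G g"
  unfolding irredundant_def
proof
  fix v assume v: "v \<in> broadcasting G g"
  then have vG: "v \<in> verts G" and pos: "g v > 0" by (auto simp: broadcasting_def)
  show "private_boundary G g v \<noteq> {}"
  proof (cases "g v = 1")
    case True
    have "\<not> hears G (g(v := g v - 1)) v w" for w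
    proof
      assume w: "hears G (g(v := g v - 1)) v w"
      then have "w \<noteq> v" using True by (auto simp: hears_def broadcasting_def)
      with w have "w \<in> broadcasting G g" "gdist G v w \<le> ereal (real (g w))"
        by (auto simp: hears_def broadcasting_def)
      moreover have "ereal (real (g w)) \<le> ereal (real (g v + g w))" by simp
      ultimately show False using sep[OF v, of w] \<open>w \<noteq> v\<close>
        by (cases "gdist G v w") auto
    qed
    then have "v \<in> private_boundary G g v"
      using vG gdist_self[OF vG] by (auto simp: private_boundary_def broadcast_nbhd_def)
    then show ?thesis by blast
  next
    case False
    obtain x where x: "x \<in> verts G" "gdist G v x = ereal (real (g v))"
      using ex_boundary_vertex[OF assms(1) vG] by blast
    have "\<not> hears G (g(v := g v - 1)) x w" for w
    proof
      assume w: "hears G (g(v := g v - 1)) x w"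
      show False
      proof (cases "w = v")
        case True
        with w x pos show False using gdist_commute[of x v]
          by (auto simp: hears_def)
      next
        case wv: False
        with w have "w \<in> broadcasting G g" and hx: "gdist G x w \<le> ereal (real (g w))"
          by (auto simp: hears_def broadcasting_def)
        then have "ereal (real (g v + g w)) < gdist G v w"
          using sep[OF v, of w] wv False by auto
        also have "\<dots> \<le> gdist G v x + gdist G x w" by (rule gdist_triangle)
        also have "\<dots> \<le> ereal (real (g v)) + ereal (real (g w))"
          unfolding x(2) using hx by (rule add_left_mono)
        finally show False by simp
      qed
    qed
    then have "x \<in> private_boundary G g v"
      using x gdist_commute[of x v] by (auto simp: private_boundary_def broadcast_nbhd_def)
    then show ?thesis by blast
  qed
qed

section \<open>Rounded halves of an h-independent broadcast\<close>

lemma h_independent_less_gdist: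
  assumes "h_independent G f" "u \<in> broadcasting G f" "v \<in> broadcasting G f" "u \<noteq> v"
    and "k \<le> Suc (max (f u) (f v))"
  shows "ereal (real k) \<le> gdist G u v"
proof -
  have "\<not> hears G f u v" "\<not> hears G f v u"
    using assms by (auto simp: h_independent_def)
  then have *: "ereal (real (f v)) < gdist G u v" "ereal (real (f u)) < gdist G u v"
    using assms(2,3) gdist_commute[of u v] by (auto simp: hears_def broadcasting_def)
  \<comment> \<open>Distances are integers or infinite, so exceeding both values means exceeding
    their maximum by at least 1.\<close>
  show ?thesis
    by (rule gdist_nat_or_infinity[of u v]) (use * assms(5) in auto)
qed

lemma alpha_h_less_2_alpha_bn:
  assumes "0 < alpha_h G"
  shows "alpha_h G < 2 * alpha_bn G"
proof -
  obtain f where f: "h_independent G f" and wf: "broadcast_weight G f = alpha_h G"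
    by (rule alpha_h_attained)
  from wf assms obtain z where z: "z \<in> verts G" "f z > 0"
    by (metis broadcast_weight_def gr0I sum.neutral less_irrefl)
  \<comment> \<open>With \<open>m\<close> the larger of two values, the halves add up to at most
    \<open>m + 1\<close>: either \<open>2 * ((m + 1) div 2)\<close>, or
    \<open>(m + 1) div 2 + m div 2 + 1\<close> if \<open>z\<close> is involved. The extra 1 at
    \<open>z\<close> gives \<open>2 * g z > f z\<close> for either parity.\<close>
  define g where "g v = (if v = z then f v div 2 + 1 else (f v + 1) div 2)" for v
  have bc: "broadcast G g"
    by (rule broadcast_mono[of G f]) (use f z in \<open>auto simp: h_independent_def g_def\<close>)
  have br: "broadcasting G g = broadcasting G f"
    using z by (auto simp: broadcasting_def g_def)
  have "bn_independent G g"
    by (rule bn_independentI[OF bc], rule h_independent_less_gdist[OF f])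
      (auto simp: br g_def max_def)
  then have "broadcast_weight G g \<le> alpha_bn G" by (rule bn_independent_weight_le)
  moreover have "(\<Sum>v \<in> verts G. f v) < (\<Sum>v \<in> verts G. 2 * g v)"
    by (rule sum_strict_mono_ex1) (use z in \<open>auto simp: g_def\<close>)
  ultimately show ?thesis
    using wf by (simp add: broadcast_weight_def sum_distrib_left[symmetric])
qed

lemma alpha_h_less_3_alpha_bnr:
  assumes "0 < alpha_h G"
  shows "alpha_h G < 3 * alpha_bnr G"
proof -
  obtain f where f: "h_independent G f" and wf: "broadcast_weight G f = alpha_h G"
    by (rule alpha_h_attained)
  from wf assms obtain z where z: "z \<in> verts G" "f z > 0"
    by (metis broadcast_weight_def gr0I sum.neutral less_irrefl)
  \<comment> \<open>For positive \<open>k\<close> other than 1, \<open>3 * (k div 2)\<close> is at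
    least \<open>k\<close>, with equality only at 3. Raising the value at \<open>z\<close> to 2 in
    that case makes the final inequality strict.\<close>
  define g where
    "g v = (if v = z \<and> f v = 3 then 2 else if f v = 1 then 1 else f v div 2)" for v
  have bc: "broadcast G g"
    by (rule broadcast_mono[of G f]) (use f in \<open>auto simp: h_independent_def g_def\<close>)
  have br: "broadcasting G g = broadcasting G f"
    by (auto simp: broadcasting_def g_def)
  \<comment> \<open>Two vertices of value 1 may be at distance 2, so the sum inequality can be an
    equality; the case \<open>g u = 1\<close> is served by the weaker alternative.\<close>
  have sep: "ereal (real (g u + g v)) \<le> gdist G u v"
      "ereal (real (g u + g v)) < gdist G u v \<or> g u = 1 \<and> ereal (real (g v)) < gdist G u v"
    if "u \<in> broadcasting G g" "v \<in> broadcasting G g" "u \<noteq> v" for u v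
  proof -
    have pos: "f u > 0" "f v > 0" using that br by (auto simp: broadcasting_def)
    have D: "ereal (real k) \<le> gdist G u v" if "k \<le> Suc (max (f u) (f v))" for k
      using h_independent_less_gdist[OF f _ _ \<open>u \<noteq> v\<close> that] \<open>u \<in> _\<close> \<open>v \<in> _\<close> br by auto
    show "ereal (real (g u + g v)) \<le> gdist G u v"
      by (rule D) (use pos that in \<open>auto simp: g_def max_def\<close>)
    show "ereal (real (g u + g v)) < gdist G u v \<or> g u = 1 \<and> ereal (real (g v)) < gdist G u v"
    proof (cases "g u = 1")
      case True
      have "ereal (real (Suc (g v))) \<le> gdist G u v"
        by (rule D) (use pos that in \<open>auto simp: g_def max_def\<close>)
      then have "ereal (real (g v)) < gdist G u v" by (auto intro: less_le_trans[rotated])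
      then show ?thesis using True by simp
    next
      case False
      have "ereal (real (Suc (g u + g v))) \<le> gdist G u v"
        by (rule D) (use False pos that in \<open>auto simp: g_def max_def split: if_splits\<close>)
      then show ?thesis by (auto intro: less_le_trans[rotated])
    qed
  qed
  have "bnr_independent G g"
    unfolding bnr_independent_def using bn_independentI[OF bc] irredundantI[OF bc] sep by blast
  then have "broadcast_weight G g \<le> alpha_bnr G" by (rule bnr_independent_weight_le)
  moreover have "f z < 3 * g z"
    unfolding g_def using z(2) by (simp, presburger)
  then have "(\<Sum>v \<in> verts G. f v) < (\<Sum>v \<in> verts G. 3 * g v)"
    by (intro sum_strict_mono_ex1) (use z in \<open>auto simp: g_def\<close>)
  ultimately show ?thesis
    using wf by (simp add: broadcast_weight_def sum_distrib_left[symmetric])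
qed

end

section \<open>Graphs with prescribed distances\<close>

definition metric_graph :: "'a set \<Rightarrow> ('a \<Rightarrow> 'a \<Rightarrow> nat) \<Rightarrow> ('a, 'a \<times> 'a) pre_digraph" where
  "metric_graph V D =
     \<lparr>verts = V, arcs = {(u, v). u \<in> V \<and> v \<in> V \<and> D u v = 1}, tail = fst, head = snd\<rparr>"

text \<open>Axioms making \<open>D\<close> the distance of \<open>metric_graph V D\<close>:
  \<open>triangle\<close> bounds the length of every walk from below, and \<open>geodesic\<close>
  provides the first step of a walk of length \<open>D x y\<close>. The examples can then be
  computed from explicit formulas.\<close>

locale graph_metric =
  fixes V :: "'a set" and D :: "'a \<Rightarrow> 'a \<Rightarrow> nat"
  assumes finite_V: "finite V"
    and nonempty: "V \<noteq> {}"
    and nontrivial: "x \<in> V \<Longrightarrow> \<exists>y \<in> V. x \<noteq> y"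
    and zero_iff: "D x y = 0 \<longleftrightarrow> x = y"
    and commute: "D x y = D y x"
    and triangle: "D x z \<le> D x y + D y z"
    and geodesic: "x \<in> V \<Longrightarrow> y \<in> V \<Longrightarrow> x \<noteq> y \<Longrightarrow> \<exists>z \<in> V. D x z = 1 \<and> D x y = Suc (D z y)"
begin

abbreviation "G \<equiv> metric_graph V D"

lemma verts_metric_graph [simp]: "verts G = V"
  by (simp add: metric_graph_def)

sublocale graph G
proof
  show "finite (arcs G)"
    using finite_V by (auto simp: metric_graph_def intro: finite_subset[of _ "V \<times> V"])
  show "symmetric G"
    using commute by (auto simp: symmetric_conv metric_graph_def)
qed (use finite_V zero_iff[THEN iffD2] in \<open>auto simp: metric_graph_def arc_to_ends_def\<close>)

lemma D_le_length: "awalk u p v \<Longrightarrow> D u v \<le> length p"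
proof (induction p arbitrary: u)
  case Nil
  then show ?case using zero_iff by (auto simp: awalk_Nil_iff)
next
  case (Cons e p)
  then have "D u (head G e) = 1" "D (head G e) v \<le> length p"
    by (auto simp: awalk_Cons_iff, auto simp: metric_graph_def)
  then show ?case using triangle[of u v "head G e"] by simp
qed

lemma ex_awalk_of_length_D: "u \<in> V \<Longrightarrow> v \<in> V \<Longrightarrow> \<exists>p. awalk u p v \<and> length p = D u v"
proof (induction "D u v" arbitrary: u)
  case 0
  then show ?case using zero_iff[of u v] by (intro exI[of _ "[]"]) (auto simp: awalk_Nil_iff)
next
  case (Suc n)
  then obtain z where z: "z \<in> V" "D u z = 1" "D u v = Suc (D z v)"
    using geodesic[of u v] zero_iff[of u v] by (metis nat.distinct(1))
  then obtain p where p: "awalk z p v" "length p = D z v"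
    using Suc by (metis Suc_inject)
  have "awalk u ((u, z) # p) v"
    using p z Suc.prems by (simp add: awalk_Cons_iff) (simp add: metric_graph_def)
  with p z show ?case by (intro exI[of _ "(u, z) # p"]) simp
qed

lemma gdist_eq: "u \<in> V \<Longrightarrow> v \<in> V \<Longrightarrow> gdist G u v = ereal (real (D u v))"
  by (intro antisym gdist_greatest) (use ex_awalk_of_length_D[of u v] gdist_le_length D_le_length in force)+

lemma no_isolated: "no_isolated_verts G"
  unfolding no_isolated_verts_def
proof
  fix v assume v: "v \<in> verts G"
  then obtain y where y: "y \<in> V" "v \<noteq> y" using nontrivial[of v] by auto
  then obtain z where z: "z \<in> V" "D v z = 1" using geodesic[of v y] v by auto
  have "v \<rightarrow>\<^bsub>G\<^esub> z"
    using v z by (intro dominatesI[of "(v, z)"]) (auto simp: arc_to_ends_def metric_graph_def)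
  then show "\<exists>u. v \<rightarrow>\<^bsub>G\<^esub> u" ..
qed

lemma strongly_connected: "strongly_connected G"
  unfolding strongly_connected_def
  using nonempty ex_awalk_of_length_D by (auto simp: reachable_awalk)

text \<open>The graph is connected, so it is its own only component, and its eccentricities are
  attained.\<close>

lemma broadcast_iff:
  "broadcast G f \<longleftrightarrow> (\<forall>v \<in> V. \<exists>u \<in> V. f v \<le> D v u)"
proof
  assume f: "broadcast G f"
  show "\<forall>v \<in> V. \<exists>u \<in> V. f v \<le> D v u"
  proof
    fix v assume "v \<in> V"
    then show "\<exists>u \<in> V. f v \<le> D v u"
      using broadcast_reaches[OF f, of v] gdist_eq by (metis verts_metric_graph ereal_less_eq(3) of_nat_le_iff)
  qed
next
  assume "\<forall>v \<in> V. \<exists>u \<in> V. f v \<le> D v u"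
  then show "broadcast G f"
    by (intro strongly_connected_broadcastI strongly_connected) (auto simp: gdist_eq)
qed

lemma broadcasting_iff: "v \<in> broadcasting G f \<longleftrightarrow> v \<in> V \<and> f v > 0"
  by (simp add: broadcasting_def)

lemma hears_iff: "hears G f u v \<longleftrightarrow> u \<in> V \<and> v \<in> V \<and> f v > 0 \<and> D u v \<le> f v"
  by (auto simp: hears_def broadcasting_iff gdist_eq)

lemma bn_independentD:
  assumes "bn_independent G f" "hears G f x v" "hears G f x w" "v \<noteq> w"
  shows "D x v = f v"
proof -
  have "ereal (real (f v)) \<le> gdist G x v"
    using assms unfolding bn_independent_def hears_def by blast
  then show ?thesis using assms(2) by (auto simp: hears_iff gdist_eq)
qed

lemma h_independent_iff:
  "h_independent G f \<longleftrightarrow> (\<forall>v \<in> V. \<exists>u \<in> V. f v \<le> D v u) \<and>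
    (\<forall>u \<in> V. \<forall>v \<in> V. u \<noteq> v \<longrightarrow> f u > 0 \<longrightarrow> f v > 0 \<longrightarrow> f v < D u v)"
  unfolding h_independent_def broadcast_iff by (auto simp: hears_iff broadcasting_iff not_le)

lemma irredundantD:
  assumes "irredundant G f" "v \<in> V" "f v > 0"
  obtains x where "x \<in> V" "D x v \<le> f v" "\<And>w. \<not> hears G (f(v := f v - 1)) x w"
proof -
  have "private_boundary G f v \<noteq> {}"
    using assms by (auto simp: irredundant_def broadcasting_iff)
  then show thesis
    using that assms(2) by (auto simp: private_boundary_def broadcast_nbhd_def gdist_eq)
qed

end

section \<open>Paths\<close>

text \<open>One of the two truncated differences vanishes, so the formula is the absolute
  difference. A geodesic moves one step towards \<open>y\<close>.\<close>

interpretation path: graph_metric "{..Suc N}" "\<lambda>u v. (u - v) + (v - u)" for N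
proof
  fix x y :: nat assume "x \<in> {..Suc N}" "y \<in> {..Suc N}" "x \<noteq> y"
  then show "\<exists>z \<in> {..Suc N}. (x - z) + (z - x) = 1 \<and> (x - y) + (y - x) = Suc ((z - y) + (y - z))"
    by (intro bexI[of _ "if x < y then x + 1 else x - 1"]) auto
next
  fix x :: nat
  show "\<exists>y\<in>{..Suc N}. x \<noteq> y" by (intro bexI[of _ "if x = 0 then 1 else 0"]) auto
qed auto

lemma path_alpha_h: "2 * N \<le> alpha_h (path.G N)"
proof -
  \<comment> \<open>The ends are at distance \<open>Suc N\<close>, just above the value
    \<open>N\<close>. Writing \<open>f\<close> as a sum of two one-point functions lets its weight
    split.\<close>
  define f where "f v = (if v = 0 then N else 0) + (if v = Suc N then N else 0)" for v
  have "h_independent (path.G N) f"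
    unfolding path.h_independent_iff
  proof (intro conjI ballI impI)
    fix v assume "v \<in> {..Suc N}"
    show "\<exists>u \<in> {..Suc N}. f v \<le> (v - u) + (u - v)"
      by (rule bexI[of _ "if v = 0 then Suc N else 0"]) (auto simp: f_def)
  next
    fix u v :: nat assume "u \<noteq> v" "0 < f u" "0 < f v"
    then show "f v < (u - v) + (v - u)" by (auto simp: f_def split: if_splits)
  qed
  moreover have "broadcast_weight (path.G N) f = 2 * N"
    by (simp add: broadcast_weight_def f_def sum.distrib)
  ultimately show ?thesis using path.h_independent_weight_le[of N f] by simp
qed

text \<open>Every vertex claims as many edges as its value, the claims are disjoint, and the path
  has \<open>Suc N\<close> edges.\<close>

lemma path_alpha_bn: "alpha_bn (path.G N) \<le> Suc N"
proof -
  obtain f where f: "bn_independent (path.G N) f"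
    and wf: "broadcast_weight (path.G N) f = alpha_bn (path.G N)"
    by (rule path.alpha_bn_attained)
  text \<open>The number \<open>i\<close> stands for the edge between \<open>i\<close> and \<open>i + 1\<close>; \<open>E v\<close> consists of \<open>f v\<close> edges
    on one side of \<open>v\<close>, both of whose ends hear \<open>v\<close>.\<close>
  define E where "E v = (if v + f v \<le> Suc N then {v..<v + f v} else {v - f v..<v})" for v
  have "broadcast (path.G N) f" using f by (simp add: bn_independent_def)
  then have reach: "\<exists>u \<le> Suc N. f v \<le> (v - u) + (u - v)" if "v \<le> Suc N" for v
    using that unfolding path.broadcast_iff by auto
  \<comment> \<open>The broadcast condition ensures that \<open>f v\<close> edges fit on at least
    one side, so \<open>v - f v\<close> is not truncated when the left side is taken.\<close>
  have card_E: "card (E v) = f v" if "v \<le> Suc N" for v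
    using reach[OF that] by (auto simp: E_def)
  have disj: "E u \<inter> E v = {}" if uv: "u \<le> Suc N" "v \<le> Suc N" "u \<noteq> v" for u v
  proof (rule ccontr)
    assume "E u \<inter> E v \<noteq> {}"
    then obtain i where i: "i \<in> E u" "i \<in> E v" by blast
    \<comment> \<open>Both ends of an edge claimed by \<open>u\<close> and \<open>v\<close> hear
      both, so bn-independence puts both ends at distance \<open>f u\<close> from \<open>u\<close>;
      but adjacent vertices of a path have different distances from \<open>u\<close>.\<close>
    have h: "hears (path.G N) f i w \<and> hears (path.G N) f (Suc i) w"
      if "i \<in> E w" "w \<le> Suc N" for w
      using that unfolding path.hears_iff E_def by (auto split: if_splits)
    have "(i - u) + (u - i) = f u" "(Suc i - u) + (u - Suc i) = f u"
      using path.bn_independentD[OF f _ _ uv(3)] h[of u] h[of v] i uv by auto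
    then show False by arith
  qed
  have "broadcast_weight (path.G N) f = (\<Sum>v \<le> Suc N. card (E v))"
    by (simp add: broadcast_weight_def card_E del: sum.atMost_Suc)
  also have "\<dots> = card (\<Union>v \<in> {..Suc N}. E v)"
    by (rule card_UN_disjoint[symmetric]) (use disj in \<open>auto simp: E_def\<close>)
  also have "\<dots> \<le> card {..<Suc N}"
    by (intro card_mono) (auto simp: E_def split: if_splits)
  finally show ?thesis using wf by simp
qed

section \<open>Spiders\<close>

text \<open>Vertex \<open>0\<close> is the centre of the spider; its legs are \<open>0, 2 * i + 1, 2 * i + 2\<close>.\<close>

definition spoke :: "nat \<Rightarrow> nat" where
  "spoke v = (v + 1) div 2"

definition height :: "nat \<Rightarrow> nat" where
  "height v = (if v = 0 then 0 else if odd v then 1 else 2)"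

text \<open>Different legs are joined through the centre. The centre has a spoke number of its own,
  but its height 0 makes the second formula correct for it too.\<close>

definition spider_dist :: "nat \<Rightarrow> nat \<Rightarrow> nat" where
  "spider_dist u v = (if spoke u = spoke v then (height u - height v) + (height v - height u)
     else height u + height v)"

lemma spoke_simps [simp]:
  "spoke 0 = 0" "spoke (Suc (2 * i)) = Suc i" "spoke (Suc (Suc (2 * i))) = Suc i"
  by (auto simp: spoke_def)

lemma height_simps [simp]:
  "height 0 = 0" "height (Suc (2 * i)) = 1" "height (Suc (Suc (2 * i))) = 2"
  by (auto simp: height_def)

lemma spider_vertex_cases:
  obtains "v = 0" | i where "v = Suc (2 * i)" | i where "v = Suc (Suc (2 * i))"
proof (cases v)
  case (Suc u)
  then show thesis using that(2,3) by (cases "even u") (auto elim!: evenE oddE)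
qed (use that in simp)

lemma spider_dist_eq_0_iff: "spider_dist u v = 0 \<longleftrightarrow> u = v"
  by (cases u rule: spider_vertex_cases; cases v rule: spider_vertex_cases)
    (auto simp: spider_dist_def)

lemma spider_dist_triangle: "spider_dist u w \<le> spider_dist u v + spider_dist v w"
  unfolding spider_dist_def by (auto split: if_splits)

text \<open>There are \<open>n + 1\<close> legs. A geodesic goes from the centre to the inner vertex
  of the leg of \<open>y\<close>, from an inner vertex to its leaf if that is \<open>y\<close> and
  to the centre otherwise, and from a leaf to its inner vertex.\<close>

interpretation spider: graph_metric "{..Suc (Suc (2 * n))}" spider_dist for n
proof
  fix x :: nat
  show "\<exists>y\<in>{..Suc (Suc (2 * n))}. x \<noteq> y" by (intro bexI[of _ "if x = 0 then 1 else 0"]) auto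
next
  fix x y assume xy: "x \<in> {..Suc (Suc (2 * n))}" "y \<in> {..Suc (Suc (2 * n))}" "x \<noteq> y"
  show "\<exists>z \<in> {..Suc (Suc (2 * n))}. spider_dist x z = 1 \<and> spider_dist x y = Suc (spider_dist z y)"
  proof (cases x rule: spider_vertex_cases)
    case 1
    then obtain i where "spoke y = Suc i" "i \<le> n" "0 < height y"
      using xy by (cases y rule: spider_vertex_cases) auto
    with 1 show ?thesis
      by (intro bexI[of _ "Suc (2 * i)"]) (auto simp: spider_dist_def)
  next
    case (2 i)
    show ?thesis
    proof (cases "y = Suc x")
      case True
      with xy(2) 2 show ?thesis by (intro bexI[of _ y]) (simp_all add: spider_dist_def)
    next
      case False
      with xy(3) 2 show ?thesis
        by (intro bexI[of _ 0]; cases y rule: spider_vertex_cases) (auto simp: spider_dist_def)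
    qed
  next
    case (3 i)
    with xy show ?thesis
      by (intro bexI[of _ "Suc (2 * i)"]; cases y rule: spider_vertex_cases) (auto simp: spider_dist_def)
  qed
qed (auto simp: spider_dist_eq_0_iff spider_dist_triangle, auto simp: spider_dist_def)

lemma spider_dist_center: "spider_dist 0 v = height v"
  by (auto simp: spider_dist_def spoke_def height_def)

lemma height_le_2: "height v \<le> 2"
  by (simp add: height_def)

lemma spider_dist_le_4: "spider_dist u v \<le> 4"
  using height_le_2[of u] height_le_2[of v] by (auto simp: spider_dist_def)

lemma sum_atMost_even:
  "(\<Sum>v \<le> Suc (Suc (2 * n)). f v) = f 0 + (\<Sum>i \<le> n. f (Suc (2 * i)) + f (Suc (Suc (2 * i))))"
  for f :: "nat \<Rightarrow> 'a::comm_monoid_add"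
  by (induction n) (auto simp: add.assoc)

lemma spider_alpha_h:
  assumes "0 < n"
  shows "3 * Suc n \<le> alpha_h (spider.G n)"
proof -
  define f where "f v = (if v > 0 \<and> even v then 3 else 0 :: nat)" for v :: nat
  have "h_independent (spider.G n) f"
    unfolding spider.h_independent_iff
  proof (intro conjI ballI impI)
    fix v assume "v \<in> {..Suc (Suc (2 * n))}"
    \<comment> \<open>Vertex 1, inner on the first leg, is at distance 3 from the leaves of all
      other legs; leaf 2 uses vertex 3 on the second leg, which exists because \<open>n\<close> is
      positive.\<close>
    have "f v \<le> spider_dist v (if v = 2 then 3 else 1)"
      by (auto simp: f_def spider_dist_def spoke_def height_def elim!: evenE)
    then show "\<exists>u \<in> {..Suc (Suc (2 * n))}. f v \<le> spider_dist v u"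
      by (rule bexI) (use assms in auto)
  next
    fix u v :: nat assume "u \<noteq> v" "0 < f u" "0 < f v"
    then show "f v < spider_dist u v"
      by (auto simp: f_def spider_dist_def spoke_def height_def elim!: evenE split: if_splits)
  qed
  moreover have "broadcast_weight (spider.G n) f = 3 * Suc n"
    unfolding broadcast_weight_def spider.verts_metric_graph sum_atMost_even
    by (simp add: f_def)
  ultimately show ?thesis using spider.h_independent_weight_le[of n f] by simp
qed

lemma spider_alpha_bnr: "alpha_bnr (spider.G n) \<le> n + 8"
proof -
  obtain g where g: "bnr_independent (spider.G n) g"
    and wg: "broadcast_weight (spider.G n) g = alpha_bnr (spider.G n)"
    by (rule spider.alpha_bnr_attained)
  have bn: "bn_independent (spider.G n) g" and irr: "irredundant (spider.G n) g"
    using g by (auto simp: bnr_independent_def)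
  have "broadcast (spider.G n) g" using bn by (simp add: bn_independent_def)
  then have le4: "g v \<le> 4" if "v \<le> Suc (Suc (2 * n))" for v
    using that spider_dist_le_4 unfolding spider.broadcast_iff
    by (meson atMost_iff order_trans)
  define w where "w i = g (Suc (2 * i)) + g (Suc (Suc (2 * i)))" for i
  \<comment> \<open>If both were positive, the inner vertex would hear itself and its leaf, forcing
    its own value to be its distance 0 to itself.\<close>
  have one_zero: "g (Suc (2 * i)) = 0 \<or> g (Suc (Suc (2 * i))) = 0" if "i \<le> n" for i
  proof (rule ccontr)
    assume pos: "\<not> ?thesis"
    then have "spider_dist (Suc (2 * i)) (Suc (2 * i)) = g (Suc (2 * i))"
      using that
      by (intro spider.bn_independentD[OF bn, where w = "Suc (Suc (2 * i))"])
        (auto simp: spider.hears_iff spider_dist_def spoke_def height_def)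
    with pos show False by (simp add: spider_dist_def)
  qed
  have w_le: "w i \<le> 4" if "i \<le> n" for i
    using one_zero[OF that] le4[of "Suc (2 * i)"] le4[of "Suc (Suc (2 * i))"] that
    by (auto simp: w_def)
  \<comment> \<open>The weight of a leg sits on one vertex, and a value of at least 2 covers every
    height.\<close>
  have heavy: "\<exists>v \<in> {Suc (2 * i), Suc (Suc (2 * i))}. 2 \<le> g v \<and> hears (spider.G n) g 0 v"
    if "i \<le> n" "2 \<le> w i" for i
    using one_zero[OF that(1)] that
    by (auto simp: w_def spider.hears_iff spider_dist_center height_def)
  have unique: "i = j" if ij: "i \<le> n" "j \<le> n" "2 \<le> w i" "2 \<le> w j" for i j
  proof (rule ccontr)
    assume "i \<noteq> j"
    obtain u where u: "u \<in> {Suc (2 * i), Suc (Suc (2 * i))}" "2 \<le> g u" "hears (spider.G n) g 0 u"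
      using heavy ij by blast
    obtain v where v: "v \<in> {Suc (2 * j), Suc (Suc (2 * j))}" "2 \<le> g v" "hears (spider.G n) g 0 v"
      using heavy ij by blast
    have uv: "u \<noteq> v"
    proof
      assume "u = v"
      then have "spoke u = Suc i" "spoke u = Suc j" using u(1) v(1) by (auto simp: spoke_def)
      with \<open>i \<noteq> j\<close> show False by simp
    qed
    have "height u = g u"
      using spider.bn_independentD[OF bn u(3) v(3) uv] by (simp add: spider_dist_center)
    with u have hu: "height u = 2" "g u = 2" using height_le_2[of u] by auto
    have "u \<in> {..Suc (Suc (2 * n))}" "0 < g u" using u(3) by (auto simp: spider.hears_iff)
    then obtain x where x: "x \<in> {..Suc (Suc (2 * n))}" "spider_dist x u \<le> g u"
      and silent: "\<And>z. \<not> hears (spider.G n) (g(u := g u - 1)) x z"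
      by (rule spider.irredundantD[OF irr]) blast
    \<comment> \<open>With \<open>g u\<close> lowered from 2 to 1, a private vertex must be at
      distance exactly 2 from the leaf \<open>u\<close>. Only the centre is, and it still hears
      \<open>v\<close>.\<close>
    have "\<not> spider_dist x u \<le> 1"
      using silent[of u] x(1) u(3) hu(2) unfolding spider.hears_iff by simp
    with x hu have "x = 0"
      by (auto simp: spider_dist_def height_def split: if_splits)
    with silent[of v] v(3) uv show False
      unfolding spider.hears_iff by simp
  qed
  obtain j where j: "\<And>i. i \<le> n \<Longrightarrow> i \<noteq> j \<Longrightarrow> w i \<le> 1"
  proof (cases "\<exists>j \<le> n. 2 \<le> w j")
    case True
    then obtain j where "j \<le> n" "2 \<le> w j" by blast
    then show thesis using unique[of _ j] that[of j] by (metis Suc_1 not_less_eq_eq)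
  next
    case False
    then have "w i \<le> 1" if "i \<le> n" for i using that by (metis Suc_1 not_less_eq_eq)
    then show thesis using that by blast
  qed
  have "broadcast_weight (spider.G n) g = g 0 + (\<Sum>i \<le> n. w i)"
    unfolding broadcast_weight_def spider.verts_metric_graph sum_atMost_even w_def ..
  \<comment> \<open>The centre contributes at most 4, each of the \<open>n + 1\<close> legs at most
    1, and the exceptional leg \<open>j\<close> at most 3 more.\<close>
  also have "\<dots> \<le> 4 + (\<Sum>i \<le> n. 1 + (if i = j then 3 else 0))"
  proof (intro add_mono sum_mono)
    fix i assume "i \<in> {..n}"
    then show "w i \<le> 1 + (if i = j then 3 else 0)" using j[of i] w_le[of i] by auto
  qed (use le4 in simp)
  also have "\<dots> \<le> n + 8"
    unfolding sum.distrib by (simp del: sum.atMost_Suc)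
  finally show ?thesis using wg by simp
qed

section \<open>Ratios approaching the bounds\<close>

lemma ratio_lower_bound:
  fixes a b A B :: nat
  assumes "A \<le> a" "b \<le> B" "0 < b"
  shows "real A / real B \<le> real a / real b"
  using assms by (intro frac_le) auto

lemma ex_path_ratio:
  assumes "\<epsilon> > (0::real)"
  shows "\<exists>N. 2 - \<epsilon> < real (alpha_h (path.G N)) / real (alpha_bn (path.G N))"
proof -
  \<comment> \<open>The ratio bound obtained is \<open>2 - 2 / (N + 2)\<close>.\<close>
  obtain N where N: "1 / real (Suc N) < \<epsilon> / 2"
    using assms by (meson half_gt_zero nat_approx_posE)
  let ?G = "path.G (Suc N)"
  have "0 < alpha_h ?G" using path_alpha_h[of "Suc N"] by simp
  \<comment> \<open>The strict upper bound also shows that the denominator is positive, which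
    matters because division by 0 yields 0.\<close>
  then have "0 < alpha_bn ?G" using path.alpha_h_less_2_alpha_bn[of "Suc N"] by simp
  then have "real (2 * Suc N) / real (Suc (Suc N)) \<le> real (alpha_h ?G) / real (alpha_bn ?G)"
    by (intro ratio_lower_bound path_alpha_h path_alpha_bn)
  moreover have "2 - \<epsilon> < real (2 * Suc N) / real (Suc (Suc N))"
    using N assms by (simp add: field_simps)
  ultimately show ?thesis by (intro exI[of _ "Suc N"]) linarith
qed

lemma ex_spider_ratio:
  assumes "\<epsilon> > (0::real)"
  shows "\<exists>n. 3 - \<epsilon> < real (alpha_h (spider.G n)) / real (alpha_bnr (spider.G n))"
proof -
  \<comment> \<open>The 21 comes from \<open>3 * (n + 2) = 3 * (n + 9) - 21\<close>.\<close>
  obtain n where n: "1 / real (Suc n) < \<epsilon> / 21"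
    using nat_approx_posE[of "\<epsilon> / 21"] assms by auto
  let ?G = "spider.G (Suc n)"
  have lower: "3 * Suc (Suc n) \<le> alpha_h ?G" by (rule spider_alpha_h) simp
  then have "0 < alpha_bnr ?G" using spider.alpha_h_less_3_alpha_bnr[of "Suc n"] by simp
  then have "real (3 * Suc (Suc n)) / real (Suc n + 8) \<le> real (alpha_h ?G) / real (alpha_bnr ?G)"
    by (intro ratio_lower_bound lower spider_alpha_bnr)
  moreover have "real (3 * Suc (Suc n)) / real (Suc n + 8) = 3 - 21 / (real n + 9)"
    by (simp add: field_simps)
  moreover have "21 / (real n + 9) \<le> 21 / (real n + 1)"
    by (intro divide_left_mono) auto
  moreover have "21 / (real n + 1) < \<epsilon>"
    using n by (simp add: field_simps)
  ultimately show ?thesis by (intro exI[of _ "Suc n"]) linarith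
qed

theorem theorem3p3:
  shows "(\<forall>G :: ('a, 'b) pre_digraph.
            graph G \<and> verts G \<noteq> {} \<and> no_isolated_verts G \<longrightarrow>
              real (alpha_h G) / real (alpha_bn G) < 2 \<and>
              real (alpha_h G) / real (alpha_bnr G) < 3)
       \<and> (\<forall>\<epsilon>::real. \<epsilon> > 0 \<longrightarrow> (\<exists>G :: (nat, nat \<times> nat) pre_digraph.
            graph G \<and> verts G \<noteq> {} \<and> no_isolated_verts G \<and>
              real (alpha_h G) / real (alpha_bn G) > 2 - \<epsilon>))
       \<and> (\<forall>\<epsilon>::real. \<epsilon> > 0 \<longrightarrow> (\<exists>G :: (nat, nat \<times> nat) pre_digraph.
            graph G \<and> verts G \<noteq> {} \<and> no_isolated_verts G \<and>
              real (alpha_h G) / real (alpha_bnr G) > 3 - \<epsilon>))"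
proof (intro conjI allI impI)
  fix G :: "('a, 'b) pre_digraph"
  assume "graph G \<and> verts G \<noteq> {} \<and> no_isolated_verts G"
  then interpret graph G by simp
  \<comment> \<open>If \<open>alpha_h G\<close> is positive, the strict product bound forces
    \<open>b\<close> to be positive and can be divided; otherwise the quotient is 0.\<close>
  have ratio: "real (alpha_h G) / real b < real c"
    if "0 < alpha_h G \<Longrightarrow> alpha_h G < c * b" "0 < c" for b c
  proof (cases "alpha_h G = 0")
    case False
    then have "alpha_h G < c * b" using that by simp
    moreover from this have "0 < b" by (cases b) auto
    ultimately show ?thesis
      by (simp add: divide_less_eq) (metis of_nat_less_iff of_nat_mult)
  qed (use that in simp)
  show "real (alpha_h G) / real (alpha_bn G) < 2"
    using ratio[of 2, OF alpha_h_less_2_alpha_bn] by simp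
  show "real (alpha_h G) / real (alpha_bnr G) < 3"
    using ratio[of 3, OF alpha_h_less_3_alpha_bnr] by simp
next
  fix \<epsilon> :: real assume "\<epsilon> > 0"
  then obtain N where "2 - \<epsilon> < real (alpha_h (path.G N)) / real (alpha_bn (path.G N))"
    using ex_path_ratio by blast
  then show "\<exists>G :: (nat, nat \<times> nat) pre_digraph.
      graph G \<and> verts G \<noteq> {} \<and> no_isolated_verts G \<and> real (alpha_h G) / real (alpha_bn G) > 2 - \<epsilon>"
    by (intro exI[of _ "path.G N"] conjI path.graph_axioms path.no_isolated)
      (use path.nonempty in \<open>simp_all only: path.verts_metric_graph not_False_eq_True\<close>)
next
  fix \<epsilon> :: real assume "\<epsilon> > 0"
  then obtain n where "3 - \<epsilon> < real (alpha_h (spider.G n)) / real (alpha_bnr (spider.G n))"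
    using ex_spider_ratio by blast
  then show "\<exists>G :: (nat, nat \<times> nat) pre_digraph.
      graph G \<and> verts G \<noteq> {} \<and> no_isolated_verts G \<and> real (alpha_h G) / real (alpha_bnr G) > 3 - \<epsilon>"
    by (intro exI[of _ "spider.G n"] conjI spider.graph_axioms spider.no_isolated)
      (use spider.nonempty in \<open>simp_all only: spider.verts_metric_graph not_False_eq_True\<close>)
qed

end
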